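(* Let $\emptyset\ne S\subset\{0,1\}^n$, let $f$ be a real-valued function on $\mathbb{R}^n$ with $f(x)\in\mathbb{Z}$ for every $x\in\{0,1\}^n$, let $\zeta=\min\{f(x):x\in S\}$, and let $\eta\in\mathbb{Z}$ satisfy $\zeta\le\eta$. Let $\Phi:\mathbb{R}^n\to\mathbb{S}^\ell$ be a mapping such that $\Phi(x)\in\mathbb{S}^\ell\cap\mathbb{Z}^{\ell\times\ell}$ for every $x\in\{0,1\}^n$, let $Q\in\mathbb{S}^\ell\cap\mathbb{Z}^{\ell\times\ell}$ satisfy $\langle Q,\Phi(x)\rangle=f(x)$ for every $x\in\{0,1\}^n$, and let $\widehat S\subseteq\mathbb{S}^\ell$ be a closed convex set with $\Phi(S)\subset\widehat S$. Put $\hat\zeta=\min\{\langle Q,X\rangle:X\in\widehat S\}$. Let $\widetilde S^0=\widehat S$ and let $\widetilde S^1,\widetilde S^2,\dots$ be generated from $\widetilde S^0$ by the successive cutting inequality technique described in the context, with arbitrary choices of the integer data at each iteration. Let $\tilde\zeta^k=\min\{\langle Q,X\rangle:X\in\widetilde S^k\}$ for $k=1,2,\dots$. Then $$\hat\zeta\le\tilde\zeta^k\le\tilde\zeta^{k+1}\le\zeta\qquad(k=1,2,\dots).$$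
   Context: $\mathbb{S}^\ell$ is the linear space of real symmetric $\ell\times\ell$ matrices, and $\langle U,V\rangle=\sum_{i,j=1}^{\ell}U_{ij}V_{ij}$. All minima are read as infima in $[-\infty,+\infty]$, with value $+\infty$ over an empty set. Successive cutting inequality technique (SCIT) for $\widehat S$: given $\widetilde S^k$ ($k\ge 0$), choose finitely many matrices $G_j\in\mathbb{S}^\ell\cap\mathbb{Z}^{\ell\times\ell}$ and integers $\alpha_j\in\mathbb{Z}$ ($j=1,\dots,m$; the choice may depend on $k$). For each $j$ let $$\tilde\zeta_{{\rm a}j}=\min\{\langle Q,X\rangle:X\in\widetilde S^k,\ \langle G_j,X\rangle\le\alpha_j\},$$ let $J=\{j:\eta<\tilde\zeta_{{\rm a}j}\}$, and set $$\widetilde S^{k+1}=\{X\in\widetilde S^k:\langle G_j,X\rangle\ge\alpha_j+1\ (j\in J)\}.$$ *)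

theory Defs
  imports "HOL-Analysis.Analysis"
begin

definition sym_mats :: "(real ^ 'l ^ 'l) set" where
  "sym_mats = {X. transpose X = X}"

definition int_sym_mats :: "(real ^ 'l ^ 'l) set" where
  "int_sym_mats = {X \<in> sym_mats. \<forall>i j. X $ i $ j \<in> \<int>}"

definition binary_vecs :: "(real ^ 'n) set" where
  "binary_vecs = {x. \<forall>i. x $ i \<in> {0, 1}}"

text \<open>A minimum is an infimum in the extended reals; it is \<open>\<infinity>\<close> on the empty set.\<close>

definition minval :: "('a \<Rightarrow> real) \<Rightarrow> 'a set \<Rightarrow> ereal" where
  "minval g A = (INF x\<in>A. ereal (g x))"

text \<open>The inner product of the library on \<open>real ^ 'l ^ 'l\<close> is the trace inner product:
  \<open>U \<bullet> V\<close> is the sum of the products \<open>U $ i $ j * V $ i $ j\<close>.\<close>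

definition scit_J ::
  "real ^ 'l ^ 'l \<Rightarrow> int \<Rightarrow> (nat \<Rightarrow> real ^ 'l ^ 'l) \<Rightarrow> (nat \<Rightarrow> int) \<Rightarrow> nat \<Rightarrow> (real ^ 'l ^ 'l) set \<Rightarrow> nat set"
where
  "scit_J Q \<eta> G \<alpha> m T =
     {j \<in> {1..m}. ereal (of_int \<eta>) < minval (\<lambda>X. Q \<bullet> X) {X \<in> T. G j \<bullet> X \<le> of_int (\<alpha> j)}}"

definition scit_step ::
  "real ^ 'l ^ 'l \<Rightarrow> int \<Rightarrow> (nat \<Rightarrow> real ^ 'l ^ 'l) \<Rightarrow> (nat \<Rightarrow> int) \<Rightarrow> nat \<Rightarrow> (real ^ 'l ^ 'l) set \<Rightarrow> (real ^ 'l ^ 'l) set"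
where
  "scit_step Q \<eta> G \<alpha> m T =
     {X \<in> T. \<forall>j \<in> scit_J Q \<eta> G \<alpha> m T. G j \<bullet> X \<ge> of_int (\<alpha> j + 1)}"

end

theory Submission
  imports Defs
begin

text \<open>
  The sets shrink from step to step, so the minimal values can only increase. The content is the
  upper bound by the minimum of \<open>f\<close> over \<open>S\<close>. A step may cut off points of the
  relaxation, even lifts \<open>\<Phi> x\<close> of points \<open>x \<in> S\<close>, but never an integral point whose objective value
  is at most \<open>\<eta>\<close> (\<open>integral_point_survives_step\<close>): at such a point each \<open>G j \<bullet> X\<close> is an integer,
  hence either at most \<open>\<alpha> j\<close> or at least \<open>\<alpha> j + 1\<close>; in the first case the point is feasible for
  the \<open>j\<close>-th subproblem and keeps its minimum at or below \<open>\<eta>\<close>, so that no cut is made for \<open>j\<close>.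
  By induction the lifts of all \<open>x \<in> S\<close> with \<open>f x \<le> \<eta>\<close> belong to every relaxation. Since
  \<open>f\<close> is integral on \<open>S\<close> and its infimum there is at most \<open>\<eta>\<close>, such points exist, and
  they alone determine the infimum (\<open>minval_le_of_bounded_points\<close>).
\<close>

lemma minval_antimono: "A \<subseteq> B \<Longrightarrow> minval g B \<le> minval g A"
  unfolding minval_def by (rule INF_superset_mono) auto

lemma minval_le: "x \<in> A \<Longrightarrow> minval g A \<le> ereal (g x)"
  unfolding minval_def by (rule INF_lower)

text \<open>
  Integrality replaces compactness: from an infimum at most \<open>\<eta>\<close> one only gets points with
  \<open>f x < \<eta> + 1\<close>, but for an integral \<open>f\<close> this already means \<open>f x \<le> \<eta>\<close>.
\<close>

lemma exists_point_below_int_bound: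
  assumes int: "\<And>x. x \<in> S \<Longrightarrow> f x \<in> \<int>"
    and bound: "minval f S \<le> ereal (of_int \<eta>)"
  obtains x where "x \<in> S" and "f x \<le> of_int \<eta>"
proof -
  have "minval f S < ereal (of_int (\<eta> + 1))"
    using bound by (rule le_less_trans) simp
  then obtain x where x: "x \<in> S" "f x < of_int (\<eta> + 1)"
    unfolding minval_def INF_less_iff by auto
  moreover obtain z where "f x = of_int z"
    using int[OF x(1)] by (auto elim: Ints_cases)
  ultimately show thesis
    using that by simp
qed

text \<open>
  Points of \<open>S\<close> with value above \<open>\<eta>\<close> may have lost their lifts, but they are dominated by a point
  with value at most \<open>\<eta>\<close>.
\<close>

lemma minval_le_of_bounded_points:
  assumes int: "\<And>x. x \<in> S \<Longrightarrow> f x \<in> \<int>"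
    and bound: "minval f S \<le> ereal (of_int \<eta>)"
    and lift: "\<And>x. x \<in> S \<Longrightarrow> f x \<le> of_int \<eta> \<Longrightarrow> \<Phi> x \<in> T \<and> g (\<Phi> x) = f x"
  shows "minval g T \<le> minval f S"
proof -
  obtain x0 where x0: "x0 \<in> S" "f x0 \<le> of_int \<eta>"
    using exists_point_below_int_bound[OF int bound] .
  have below: "minval g T \<le> ereal (f x)" if "x \<in> S" "f x \<le> of_int \<eta>" for x
    using lift[OF that] minval_le[of "\<Phi> x" T g] by simp
  have "minval g T \<le> ereal (f x)" if "x \<in> S" for x
  proof (cases "f x \<le> of_int \<eta>")
    case True
    then show ?thesis using below that by blast
  next
    case False
    with x0(2) have "ereal (f x0) \<le> ereal (f x)" by simp
    with below[OF x0] show ?thesis by (rule order_trans)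
  qed
  then show ?thesis
    unfolding minval_def[of f] by (rule INF_greatest)
qed

lemma inner_int_sym_mats:
  assumes "U \<in> int_sym_mats" and "V \<in> int_sym_mats"
  shows "U \<bullet> V \<in> \<int>"
  using assms by (auto simp: int_sym_mats_def inner_vec_def intro!: Ints_sum Ints_mult)

lemma scit_step_subset: "scit_step Q \<eta> G \<alpha> m T \<subseteq> T"
  unfolding scit_step_def by blast

text \<open>
  A cut along an integral matrix removes no integral point from the gap
  \<open>\<alpha> j < G j \<bullet> X < \<alpha> j + 1\<close>; an integral point could only be lost from the side
  \<open>G j \<bullet> X \<le> \<alpha> j\<close>, where membership of \<open>j\<close> in the cut set forces objective values above \<open>\<eta>\<close>.
\<close>

lemma integral_point_survives_step:
  assumes X: "X \<in> T" "X \<in> int_sym_mats" and val: "Q \<bullet> X \<le> of_int \<eta>"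
    and G: "\<And>j. j \<in> {1..m} \<Longrightarrow> G j \<in> int_sym_mats"
  shows "X \<in> scit_step Q \<eta> G \<alpha> m T"
proof -
  have "of_int (\<alpha> j + 1) \<le> G j \<bullet> X" if j: "j \<in> scit_J Q \<eta> G \<alpha> m T" for j
  proof (rule ccontr)
    assume cut: "\<not> of_int (\<alpha> j + 1) \<le> G j \<bullet> X"
    have "G j \<in> int_sym_mats"
      using G j by (simp add: scit_J_def)
    then obtain z where "G j \<bullet> X = of_int z"
      using inner_int_sym_mats X(2) by (blast elim: Ints_cases)
    with cut have "G j \<bullet> X \<le> of_int (\<alpha> j)"
      by (simp only: of_int_le_iff)
    with X(1) have "minval (\<lambda>X. Q \<bullet> X) {X \<in> T. G j \<bullet> X \<le> of_int (\<alpha> j)} \<le> ereal (Q \<bullet> X)"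
      by (intro minval_le) simp
    also have "\<dots> \<le> ereal (of_int \<eta>)"
      using val by simp
    finally show False
      using j by (simp add: scit_J_def not_le[symmetric])
  qed
  with X(1) show ?thesis
    by (simp add: scit_step_def)
qed

theorem mainTheorem6:
  fixes S :: "(real ^ 'n) set"
    and f :: "real ^ 'n \<Rightarrow> real"
    and \<eta> :: int
    and \<Phi> :: "real ^ 'n \<Rightarrow> real ^ 'l ^ 'l"
    and Q :: "real ^ 'l ^ 'l"
    and S_hat :: "(real ^ 'l ^ 'l) set"
    and S_tilde :: "nat \<Rightarrow> (real ^ 'l ^ 'l) set"
    and m :: "nat \<Rightarrow> nat"
    and G :: "nat \<Rightarrow> nat \<Rightarrow> real ^ 'l ^ 'l"
    and \<alpha> :: "nat \<Rightarrow> nat \<Rightarrow> int"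
  assumes "S \<noteq> {}" and "S \<subseteq> binary_vecs"
    and "\<And>x. x \<in> binary_vecs \<Longrightarrow> f x \<in> \<int>"
    and "minval f S \<le> ereal (of_int \<eta>)"
    and "\<And>x. \<Phi> x \<in> sym_mats"
    and "\<And>x. x \<in> binary_vecs \<Longrightarrow> \<Phi> x \<in> int_sym_mats"
    and "Q \<in> int_sym_mats"
    and "\<And>x. x \<in> binary_vecs \<Longrightarrow> Q \<bullet> \<Phi> x = f x"
    and "S_hat \<subseteq> sym_mats" and "closed S_hat" and "convex S_hat"
    and "\<Phi> ` S \<subseteq> S_hat"
    and "\<And>k j. j \<in> {1..m k} \<Longrightarrow> G k j \<in> int_sym_mats"
    and "S_tilde 0 = S_hat"
    and "\<And>k. S_tilde (Suc k) = scit_step Q \<eta> (G k) (\<alpha> k) (m k) (S_tilde k)"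
  shows "\<forall>k\<ge>1.
      minval (\<lambda>X. Q \<bullet> X) S_hat \<le> minval (\<lambda>X. Q \<bullet> X) (S_tilde k)
    \<and> minval (\<lambda>X. Q \<bullet> X) (S_tilde k) \<le> minval (\<lambda>X. Q \<bullet> X) (S_tilde (k + 1))
    \<and> minval (\<lambda>X. Q \<bullet> X) (S_tilde (k + 1)) \<le> minval f S"
proof (intro allI impI conjI)
  fix k :: nat
  have step: "S_tilde (Suc i) \<subseteq> S_tilde i" for i
    unfolding assms(15) by (rule scit_step_subset)
  have "S_tilde k \<subseteq> S_tilde 0"
    using lift_Suc_antimono_le[of S_tilde, OF step] by simp
  then show "minval (\<lambda>X. Q \<bullet> X) S_hat \<le> minval (\<lambda>X. Q \<bullet> X) (S_tilde k)"
    unfolding assms(14) by (rule minval_antimono)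
  show "minval (\<lambda>X. Q \<bullet> X) (S_tilde k) \<le> minval (\<lambda>X. Q \<bullet> X) (S_tilde (k + 1))"
    using step[of k] by (intro minval_antimono) simp
  have survives: "\<Phi> x \<in> S_tilde i" if x: "x \<in> S" "f x \<le> of_int \<eta>" for x i
  proof (induction i)
    case 0
    show ?case using x(1) assms(12,14) by blast
  next
    case (Suc i)
    have "x \<in> binary_vecs" using x(1) assms(2) by blast
    then have "\<Phi> x \<in> int_sym_mats" and "Q \<bullet> \<Phi> x \<le> of_int \<eta>"
      using x(2) assms(6,8) by simp_all
    then show ?case
      unfolding assms(15) using Suc.IH assms(13) by (intro integral_point_survives_step)
  qed
  show "minval (\<lambda>X. Q \<bullet> X) (S_tilde (k + 1)) \<le> minval f S"
  proof (rule minval_le_of_bounded_points[where \<eta> = \<eta> and \<Phi> = \<Phi>])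
    show "f x \<in> \<int>" if "x \<in> S" for x
      using that assms(2,3) by blast
    show "\<Phi> x \<in> S_tilde (k + 1) \<and> Q \<bullet> \<Phi> x = f x" if "x \<in> S" "f x \<le> of_int \<eta>" for x
      using survives[OF that] that(1) assms(2,8) by blast
  qed (rule assms(4))
qed

end
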